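(* Let $\mathcal A$ be a von Neumann algebra on a Hilbert space $\mathcal H$ with cyclic and separating vector $\Omega$, let $(\mathcal A_t)_{t\ge 0}$ be a filtration of $\mathcal A$ with normal conditional expectations $\mathbb E_t:\mathcal A\to\mathcal A_t$ leaving the vector state $\omega=\langle\,\cdot\,\Omega,\Omega\rangle$ invariant, let $P_t$ be the associated orthogonal projections on $\mathcal H$, let $\tau=(q_t)_{t\in[0,+\infty)}$ be a stopping time, and let $(\xi(t))_{t\in[0,+\infty)}$ be a martingale in $\mathcal H$. Suppose that the set $\{M_\tau\xi(t): t\in[0,+\infty)\}$ is norm-bounded, where $M_\tau=M_\tau(\infty)$ is the time projection. Then the martingale $(\xi(t))$ can be stopped by $\tau$, i.e. the norm limit $\xi_\tau=\lim_{u\to\infty}M_\tau(u)\xi(u)$ exists in $\mathcal H$, and $$\xi_\tau=\lim_{t\to\infty}M_\tau\xi(t)$$ (the limit on the right existing in norm).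
   Context: Setting. $\mathcal A$ is a von Neumann algebra acting on a Hilbert space $\mathcal H$ with a cyclic and separating vector $\Omega$, and $\omega$ is the (normal faithful) vector state on $\mathcal A$ induced by $\Omega$. A filtration is an increasing family $(\mathcal A_t)_{t\ge0}$ of von Neumann subalgebras of $\mathcal A$ with $\mathcal A=\mathcal A_\infty:=(\bigcup_{t\ge0}\mathcal A_t)''$. It is assumed that for each $t\ge 0$ there is a normal conditional expectation $\mathbb E_t$ from $\mathcal A$ onto $\mathcal A_t$ with $\omega\circ\mathbb E_t=\omega$. $P_t$ is the orthogonal projection of $\mathcal H$ onto $\mathcal H_t=\overline{\mathcal A_t\Omega}$; it is determined by $P_t(x\Omega)=(\mathbb E_tx)\Omega$ for $x\in\mathcal A$, and $P_t\in\mathcal A_t'$. For $t=\infty$: $\mathbb E_\infty=\mathrm{id}$ and $P_\infty=\boldsymbol 1$. Stopping time. A stopping time $\tau=(q_t)_{t\in[0,+\infty)}$ is an increasing family of projections with $q_t\in\mathcal A_t$, $q_0=0$ and $\bigvee_{t\ge0}q_t=\boldsymbol 1$. Put $q_\infty:=\boldsymbol 1$. Time projection. Let $u\in(0,+\infty]$. For a finite partition $\theta=\{0=t_0<t_1<\dots<t_n=u\}$ of $[0,u]$ put $$M_{\tau(\theta)}(u)=\sum_{i=1}^n(q_{t_i}-q_{t_{i-1}})P_{t_i}.$$ Each $M_{\tau(\theta)}(u)$ is an orthogonal projection on $\mathcal H$, and the net $\{M_{\tau(\theta)}(u)\}_\theta$ is decreasing as $\theta$ refines. The time projection is its strong limit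 $M_\tau(u)=\lim_\theta M_{\tau(\theta)}(u)=\bigwedge_\theta M_{\tau(\theta)}(u)$; write $M_\tau=M_\tau(\infty)$. Martingales and stopping. A martingale in $\mathcal H$ is a family $(\xi(t))_{t\ge0}$ with $\xi(t)\in\mathcal H_t$ and $P_s\xi(t)=\xi(s)$ for all $0\le s\le t$. For $u\in(0,+\infty)$, the stopped element is $\xi_\tau(u)=\lim_\theta\sum_{i=1}^n(q_{t_i}-q_{t_{i-1}})\xi(t_i)$, the limit being over partitions $\theta$ of $[0,u]$ under refinement; it equals $M_\tau(u)\xi(u)$. The martingale can be stopped by $\tau$ if $\xi_\tau:=\lim_{u\to\infty}\xi_\tau(u)$ exists in norm. *)

theory Defs
  imports "HOL-Analysis.Analysis"
begin

text \<open>
  Complex Hilbert spaces. The real inner product of the class \<^class>\<open>real_inner\<close> is required to be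
  the real part of \<open>cinner\<close>, so norm, topology and completeness are those of the library; symmetry,
  positivity and definiteness of \<open>cinner\<close> on the diagonal are inherited from there.
  \<open>cinner\<close> is linear in its first argument.
\<close>

class complex_hilbert_space = real_inner + complete_space +
  fixes scaleC :: "complex \<Rightarrow> 'a \<Rightarrow> 'a" (infixr "*\<^sub>C" 75)
    and cinner :: "'a \<Rightarrow> 'a \<Rightarrow> complex"
  assumes scaleC_add_right: "c *\<^sub>C (x + y) = c *\<^sub>C x + c *\<^sub>C y"
    and scaleC_add_left: "(c + d) *\<^sub>C x = c *\<^sub>C x + d *\<^sub>C x"
    and scaleC_scaleC: "c *\<^sub>C (d *\<^sub>C x) = (c * d) *\<^sub>C x"
    and scaleR_eq_scaleC: "r *\<^sub>R x = complex_of_real r *\<^sub>C x"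
    and cinner_commute: "cinner x y = cnj (cinner y x)"
    and cinner_add_left: "cinner (x + y) z = cinner x z + cinner y z"
    and cinner_scaleC_left: "cinner (c *\<^sub>C x) y = c * cinner x y"
    and inner_eq_Re_cinner: "inner x y = Re (cinner x y)"

type_synonym 'h op = "'h \<Rightarrow> 'h"

definition bounded_clinear :: "'h::complex_hilbert_space op \<Rightarrow> bool" where
  "bounded_clinear a \<longleftrightarrow> bounded_linear a \<and> (\<forall>c x. a (c *\<^sub>C x) = c *\<^sub>C a x)"

text \<open>A bounded operator has exactly one adjoint, by the Riesz representation theorem.\<close>

definition hadj :: "'h::complex_hilbert_space op \<Rightarrow> 'h op" where
  "hadj a = (THE b. \<forall>x y. cinner (a x) y = cinner x (b y))"

text \<open>On a complex Hilbert space a bounded positive operator is automatically self-adjoint.\<close>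

definition positive_op :: "'h::complex_hilbert_space op \<Rightarrow> bool" where
  "positive_op a \<longleftrightarrow>
     bounded_clinear a \<and> (\<forall>x. cinner (a x) x \<in> \<real> \<and> 0 \<le> Re (cinner (a x) x))"

definition op_le :: "'h::complex_hilbert_space op \<Rightarrow> 'h op \<Rightarrow> bool" where
  "op_le a b \<longleftrightarrow> positive_op (\<lambda>x. b x - a x)"

definition projection :: "'h::complex_hilbert_space op \<Rightarrow> bool" where
  "projection p \<longleftrightarrow>
     bounded_clinear p \<and> p \<circ> p = p \<and> (\<forall>x y. cinner (p x) y = cinner x (p y))"

definition op_lub :: "'h::complex_hilbert_space op set \<Rightarrow> 'h op set \<Rightarrow> 'h op \<Rightarrow> bool" where
  "op_lub X D s \<longleftrightarrow>
     s \<in> X \<and> (\<forall>d\<in>D. op_le d s) \<and> (\<forall>u\<in>X. (\<forall>d\<in>D. op_le d u) \<longrightarrow> op_le s u)"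

definition orth_proj :: "'h::complex_hilbert_space set \<Rightarrow> 'h op" where
  "orth_proj S x = (THE y. y \<in> S \<and> (\<forall>z\<in>S. cinner (x - y) z = 0))"


definition commutant :: "'h::complex_hilbert_space op set \<Rightarrow> 'h op set" where
  "commutant S = {b. bounded_clinear b \<and> (\<forall>a\<in>S. a \<circ> b = b \<circ> a)}"

definition von_neumann_algebra :: "'h::complex_hilbert_space op set \<Rightarrow> bool" where
  "von_neumann_algebra A \<longleftrightarrow>
     (\<forall>a\<in>A. bounded_clinear a) \<and> (\<forall>a\<in>A. hadj a \<in> A) \<and> commutant (commutant A) = A"

definition cyclic_vector :: "'h::complex_hilbert_space op set \<Rightarrow> 'h \<Rightarrow> bool" where
  "cyclic_vector A \<Omega> \<longleftrightarrow> closure ((\<lambda>a. a \<Omega>) ` A) = UNIV"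

definition separating_vector :: "'h::complex_hilbert_space op set \<Rightarrow> 'h \<Rightarrow> bool" where
  "separating_vector A \<Omega> \<longleftrightarrow> (\<forall>a\<in>A. a \<Omega> = 0 \<longrightarrow> a = (\<lambda>x. 0))"

definition vector_functional :: "'h::complex_hilbert_space \<Rightarrow> 'h op \<Rightarrow> complex" where
  "vector_functional \<Omega> a = cinner (a \<Omega>) \<Omega>"

definition conditional_expectation ::
    "'h::complex_hilbert_space op set \<Rightarrow> 'h op set \<Rightarrow> ('h op \<Rightarrow> 'h op) \<Rightarrow> bool" where
  "conditional_expectation A B E \<longleftrightarrow>
     (\<forall>a\<in>A. E a \<in> B) \<and> (\<forall>b\<in>B. E b = b) \<and>
     (\<forall>a\<in>A. \<forall>a'\<in>A. E (\<lambda>x. a x + a' x) = (\<lambda>x. E a x + E a' x)) \<and>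
     (\<forall>a\<in>A. \<forall>c. E (\<lambda>x. c *\<^sub>C a x) = (\<lambda>x. c *\<^sub>C E a x)) \<and>
     (\<forall>a\<in>A. positive_op a \<longrightarrow> positive_op (E a)) \<and>
     (\<forall>a\<in>A. \<forall>b\<in>B. \<forall>b'\<in>B. E (b \<circ> a \<circ> b') = b \<circ> E a \<circ> b')"

text \<open>Normality: suprema of bounded upward directed sets of positive elements are preserved.\<close>

definition normal_map ::
    "'h::complex_hilbert_space op set \<Rightarrow> 'h op set \<Rightarrow> ('h op \<Rightarrow> 'h op) \<Rightarrow> bool" where
  "normal_map A B E \<longleftrightarrow>
     (\<forall>D s. D \<noteq> {} \<longrightarrow> D \<subseteq> A \<longrightarrow> (\<forall>d\<in>D. positive_op d) \<longrightarrow>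
        (\<forall>d\<in>D. \<forall>d'\<in>D. \<exists>d''\<in>D. op_le d d'' \<and> op_le d' d'') \<longrightarrow>
        op_lub A D s \<longrightarrow> op_lub B (E ` D) (E s))"

definition filtration ::
    "'h::complex_hilbert_space op set \<Rightarrow> (real \<Rightarrow> 'h op set) \<Rightarrow> bool" where
  "filtration A F \<longleftrightarrow>
     (\<forall>t\<ge>0. von_neumann_algebra (F t) \<and> F t \<subseteq> A) \<and>
     (\<forall>s\<ge>0. \<forall>t\<ge>s. F s \<subseteq> F t) \<and>
     A = commutant (commutant (\<Union>t\<in>{0..}. F t))"

definition Ht :: "(real \<Rightarrow> 'h::complex_hilbert_space op set) \<Rightarrow> 'h \<Rightarrow> real \<Rightarrow> 'h set" where
  "Ht F \<Omega> t = closure ((\<lambda>a. a \<Omega>) ` F t)"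

definition Pt :: "(real \<Rightarrow> 'h::complex_hilbert_space op set) \<Rightarrow> 'h \<Rightarrow> real \<Rightarrow> 'h op" where
  "Pt F \<Omega> t = orth_proj (Ht F \<Omega> t)"

definition stopping_time ::
    "(real \<Rightarrow> 'h::complex_hilbert_space op set) \<Rightarrow> (real \<Rightarrow> 'h op) \<Rightarrow> bool" where
  "stopping_time F q \<longleftrightarrow>
     (\<forall>t\<ge>0. projection (q t) \<and> q t \<in> F t) \<and>
     (\<forall>s\<ge>0. \<forall>t\<ge>s. op_le (q s) (q t)) \<and>
     q 0 = (\<lambda>x. 0) \<and>
     op_lub (Collect projection) (q ` {0..}) id"

definition martingale ::
    "(real \<Rightarrow> 'h::complex_hilbert_space op set) \<Rightarrow> 'h \<Rightarrow> (real \<Rightarrow> 'h) \<Rightarrow> bool" where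
  "martingale F \<Omega> \<xi> \<longleftrightarrow>
     (\<forall>t\<ge>0. \<xi> t \<in> Ht F \<Omega> t) \<and> (\<forall>s\<ge>0. \<forall>t\<ge>s. Pt F \<Omega> s (\<xi> t) = \<xi> s)"

text \<open>Extension of a family of operators to time \<open>\<infinity>\<close>, where its value is the identity.\<close>

definition ext_op :: "(real \<Rightarrow> 'h op) \<Rightarrow> ereal \<Rightarrow> 'h op" where
  "ext_op a t = (if t = \<infinity> then id else a (real_of_ereal t))"

text \<open>
  A partition \<open>0 = t\<^sub>0 < \<dots> < t\<^sub>n = u\<close> is represented by the finite set of its points, and
  \<open>partition_sum f \<theta>\<close> is the sum of the \<open>f t\<^sub>i\<^sub>-\<^sub>1 t\<^sub>i\<close>. Refinement is inclusion, so limits over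
  partitions of \<open>[0,u]\<close> are limits along \<^term>\<open>finite_subsets_at_top {0..u}\<close>: the finite subsets
  of \<open>[0,u]\<close> containing both \<open>0\<close> and \<open>u\<close> are cofinal and upward closed in it.
\<close>

definition partition_sum ::
    "('t::linorder \<Rightarrow> 't \<Rightarrow> 'a::comm_monoid_add) \<Rightarrow> 't set \<Rightarrow> 'a" where
  "partition_sum f \<theta> =
     (let ts = sorted_list_of_set \<theta> in \<Sum>i = 1..<length ts. f (ts ! (i - 1)) (ts ! i))"

definition partition_time_proj ::
    "(real \<Rightarrow> 'h::complex_hilbert_space op set) \<Rightarrow> 'h \<Rightarrow> (real \<Rightarrow> 'h op) \<Rightarrow> ereal set \<Rightarrow> 'h op" where
  "partition_time_proj F \<Omega> q \<theta> x =
     partition_sum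
       (\<lambda>s t. ext_op q t (ext_op (Pt F \<Omega>) t x) - ext_op q s (ext_op (Pt F \<Omega>) t x)) \<theta>"

definition time_proj ::
    "(real \<Rightarrow> 'h::complex_hilbert_space op set) \<Rightarrow> 'h \<Rightarrow> (real \<Rightarrow> 'h op) \<Rightarrow> ereal \<Rightarrow> 'h op" where
  "time_proj F \<Omega> q u x =
     Lim (finite_subsets_at_top {0..u}) (\<lambda>\<theta>. partition_time_proj F \<Omega> q \<theta> x)"

definition stopped_at ::
    "(real \<Rightarrow> 'h::complex_hilbert_space op) \<Rightarrow> (real \<Rightarrow> 'h) \<Rightarrow> real \<Rightarrow> 'h" where
  "stopped_at q \<xi> u =
     Lim (finite_subsets_at_top {0..u}) (partition_sum (\<lambda>s t. q t (\<xi> t) - q s (\<xi> t)))"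

definition can_be_stopped ::
    "(real \<Rightarrow> 'h::complex_hilbert_space op) \<Rightarrow> (real \<Rightarrow> 'h) \<Rightarrow> bool" where
  "can_be_stopped q \<xi> \<longleftrightarrow> (\<exists>l. (stopped_at q \<xi> \<longlongrightarrow> l) at_top)"

definition stopped ::
    "(real \<Rightarrow> 'h::complex_hilbert_space op) \<Rightarrow> (real \<Rightarrow> 'h) \<Rightarrow> 'h" where
  "stopped q \<xi> = Lim at_top (stopped_at q \<xi>)"

end

theory Submission
  imports Defs
begin

text \<open>
  The time projection \<open>M\<^sub>\<tau>(u)\<close> is the orthogonal projection onto the vectors \<open>k\<close> with \<open>q\<^sub>u k = k\<close> and
  \<open>q\<^sub>t k \<in> H\<^sub>t\<close> for all \<open>t \<le> u\<close>. From this description one reads off that \<open>M\<^sub>\<tau>(u) = q\<^sub>u M\<^sub>\<tau>\<close> and that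
  \<open>M\<^sub>\<tau>\<close> commutes with every \<open>P\<^sub>s\<close>. Hence \<open>\<eta>(t) = M\<^sub>\<tau> \<xi>(t)\<close> is again a martingale; being bounded, it
  has orthogonal increments of summable square norm and converges to some \<open>l\<close>. As \<open>q\<^sub>t\<close> increases
  strongly to the identity, \<open>M\<^sub>\<tau>(t) \<xi>(t) = q\<^sub>t \<eta>(t)\<close> converges to \<open>l\<close> as well.
\<close>

section \<open>Orthogonal projections in real Hilbert spaces\<close>

text \<open>First variation of the distance: with a nonzero inner product the quadratic polynomial
  in \<open>t\<close> would drop below its value at \<open>t = 0\<close>.\<close>

lemma inner_closest_point_eq_0:
  fixes v z :: "'a::real_inner"
  assumes "\<And>t. (norm v)\<^sup>2 \<le> (norm (v - t *\<^sub>R z))\<^sup>2"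
  shows "inner v z = 0"
proof (rule ccontr)
  assume nz: "inner v z \<noteq> 0"
  then have z: "inner z z \<noteq> 0" by auto
  \<comment> \<open>The vertex of that polynomial; the drop there is
    \<open>(inner v z)\<^sup>2 / inner z z\<close>.\<close>
  define t where "t = inner v z / inner z z"
  have "(norm (v - t *\<^sub>R z))\<^sup>2 = inner v v - 2 * t * inner v z + t * t * inner z z"
    by (simp add: power2_norm_eq_inner inner_diff_left inner_diff_right inner_commute algebra_simps)
  also have "\<dots> = inner v v - (inner v z)\<^sup>2 / inner z z"
    using z by (simp add: t_def power2_eq_square field_simps)
  finally have "(inner v z)\<^sup>2 / inner z z \<le> 0"
    using assms[of t] by (simp add: power2_norm_eq_inner)
  moreover have "(inner v z)\<^sup>2 / inner z z > 0"
    using nz z by (simp add: order_less_le)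
  ultimately show False by simp
qed

text \<open>A minimising sequence for the distance from \<open>x\<close> to \<open>S\<close> is
  Cauchy by the parallelogram law. Completeness and closedness give a nearest point in
  \<open>S\<close>, and \<open>inner_closest_point_eq_0\<close> makes the error orthogonal to
  \<open>S\<close>.\<close>

lemma closed_subspace_projection_exists:
  fixes S :: "'a::{real_inner,complete_space} set"
  assumes cl: "closed S" and sub: "subspace S"
  shows "\<exists>y\<in>S. \<forall>z\<in>S. inner (x - y) z = 0"
proof -
  define D where "D = (\<lambda>y. (norm (x - y))\<^sup>2) ` S"
  define d where "d = Inf D"
  have S0: "0 \<in> S" using sub by (rule subspace_0)
  have ne: "D \<noteq> {}" using S0 by (auto simp: D_def)
  have bdd: "bdd_below D" by (rule bdd_belowI[of _ 0]) (auto simp: D_def)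
  have dle: "d \<le> (norm (x - y))\<^sup>2" if "y \<in> S" for y
    unfolding d_def by (rule cInf_lower[OF _ bdd]) (use that in \<open>auto simp: D_def\<close>)
  have "\<exists>y\<in>S. (norm (x - y))\<^sup>2 < d + inverse (real (Suc n))" for n
  proof -
    have "Inf D < d + inverse (real (Suc n))" by (simp add: d_def)
    from cInf_lessD[OF ne this] show ?thesis by (auto simp: D_def)
  qed
  then obtain Y where Y: "\<And>n. Y n \<in> S" "\<And>n. (norm (x - Y n))\<^sup>2 < d + inverse (real (Suc n))"
    by metis
  have par: "(norm (Y m - Y n))\<^sup>2 \<le> 2 * inverse (real (Suc m)) + 2 * inverse (real (Suc n))" for m n
  proof -
    define w where "w = (1/2) *\<^sub>R (Y m + Y n)"
    have "w \<in> S" unfolding w_def using Y sub by (intro subspace_scale subspace_add) auto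
    \<comment> \<open>Parallelogram law for \<open>x - Y m\<close> and \<open>x - Y n\<close>, whose
      mean is \<open>x - w\<close>. As \<open>w\<close> lies in \<open>S\<close>, the last term is
      at most \<open>- 4 * d\<close>.\<close>
    have "(norm (Y m - Y n))\<^sup>2 = 2 * (norm (x - Y m))\<^sup>2 + 2 * (norm (x - Y n))\<^sup>2 - 4 * (norm (x - w))\<^sup>2"
      by (simp add: w_def power2_norm_eq_inner inner_diff_left inner_diff_right inner_add_left
          inner_add_right inner_commute algebra_simps)
    then show ?thesis using dle[OF \<open>w \<in> S\<close>] Y(2)[of m] Y(2)[of n] by linarith
  qed
  have "Cauchy Y"
  proof (rule metric_CauchyI)
    fix e :: real assume e: "0 < e"
    obtain N where N: "inverse (real (Suc N)) < e\<^sup>2 / 4"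
      using reals_Archimedean[of "e\<^sup>2 / 4"] e by auto
    have "dist (Y m) (Y n) < e" if "m \<ge> N" "n \<ge> N" for m n
    proof -
      have "inverse (real (Suc m)) \<le> inverse (real (Suc N))"
        "inverse (real (Suc n)) \<le> inverse (real (Suc N))"
        using that by (auto intro!: le_imp_inverse_le)
      with par[of m n] N have "(norm (Y m - Y n))\<^sup>2 < e\<^sup>2" by linarith
      then show ?thesis using e by (simp add: dist_norm power_less_imp_less_base)
    qed
    then show "\<exists>M. \<forall>m\<ge>M. \<forall>n\<ge>M. dist (Y m) (Y n) < e" by blast
  qed
  then obtain y where y: "Y \<longlonglongrightarrow> y" using Cauchy_convergent_iff[of Y] by (auto simp: convergent_def)
  have yS: "y \<in> S" using closed_sequentially[OF cl Y(1) y] .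
  have min: "(norm (x - y))\<^sup>2 \<le> d"
  proof (rule tendsto_le[OF sequentially_bot])
    show "(\<lambda>n. (norm (x - Y n))\<^sup>2) \<longlonglongrightarrow> (norm (x - y))\<^sup>2" by (intro tendsto_intros y)
    show "(\<lambda>n. d + inverse (real (Suc n))) \<longlonglongrightarrow> d"
      using tendsto_add[OF tendsto_const[of d] LIMSEQ_inverse_real_of_nat] by simp
    show "\<forall>\<^sub>F n in sequentially. (norm (x - Y n))\<^sup>2 \<le> d + inverse (real (Suc n))"
      by (intro always_eventually allI less_imp_le Y(2))
  qed
  have "inner (x - y) z = 0" if "z \<in> S" for z
  proof (rule inner_closest_point_eq_0)
    fix t
    have "y + t *\<^sub>R z \<in> S" using yS that sub by (intro subspace_add subspace_scale)
    from min dle[OF this] have "(norm (x - y))\<^sup>2 \<le> (norm (x - (y + t *\<^sub>R z)))\<^sup>2"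
      by (rule order_trans)
    then show "(norm (x - y))\<^sup>2 \<le> (norm (x - y - t *\<^sub>R z))\<^sup>2"
      unfolding diff_diff_eq .
  qed
  with yS show ?thesis by blast
qed

lemma projection_unique:
  fixes x :: "'a::real_inner"
  assumes "subspace S" "y \<in> S" "y' \<in> S"
    and "\<And>z. z \<in> S \<Longrightarrow> inner (x - y) z = 0" "\<And>z. z \<in> S \<Longrightarrow> inner (x - y') z = 0"
  shows "y = y'"
proof -
  have "y - y' \<in> S" using assms(1-3) by (rule subspace_diff)
  from assms(4)[OF this] assms(5)[OF this] have "inner (y - y') (y - y') = 0"
    by (simp add: inner_diff_left)
  then show ?thesis by simp
qed

section \<open>Orthogonal projectors on real inner product spaces\<close>

definition orthogonal_projector :: "('a::real_inner \<Rightarrow> 'a) \<Rightarrow> bool" where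
  "orthogonal_projector p \<longleftrightarrow>
     linear p \<and> (\<forall>x. p (p x) = p x) \<and> (\<forall>x y. inner (p x) y = inner x (p y))"

lemma orthogonal_projector_norm_sq:
  "orthogonal_projector p \<Longrightarrow> (norm (p x))\<^sup>2 = inner (p x) x"
  by (metis orthogonal_projector_def power2_norm_eq_inner inner_commute)

lemma orthogonal_projector_norm_diff_sq:
  assumes "orthogonal_projector p"
  shows "(norm (x - p x))\<^sup>2 = (norm x)\<^sup>2 - (norm (p x))\<^sup>2"
  using orthogonal_projector_norm_sq[OF assms, of x]
  by (simp add: power2_norm_eq_inner inner_diff_left inner_diff_right inner_commute)

lemma orthogonal_projector_norm_le:
  assumes "orthogonal_projector p"
  shows "norm (p x) \<le> norm x"
proof -
  have "(norm (p x))\<^sup>2 \<le> (norm x)\<^sup>2"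
    using orthogonal_projector_norm_diff_sq[OF assms, of x] zero_le_power2[of "norm (x - p x)"] by linarith
  then show ?thesis by (rule power2_le_imp_le) simp
qed

lemma orthogonal_projector_bounded_linear:
  assumes "orthogonal_projector p"
  shows "bounded_linear p"
proof -
  have "linear p" using assms by (simp add: orthogonal_projector_def)
  then show ?thesis
    using orthogonal_projector_norm_le[OF assms]
    by (intro bounded_linear_intro[where K=1]) (auto simp: linear_add linear_scale)
qed

lemma orthogonal_projector_self_adjoint:
  "orthogonal_projector p \<Longrightarrow> inner (p x) y = inner x (p y)"
  by (simp add: orthogonal_projector_def)

lemma orthogonal_projector_idem:
  "orthogonal_projector p \<Longrightarrow> p (p x) = p x"
  by (simp add: orthogonal_projector_def)

text \<open>Taking adjoints in \<open>p r = p\<close> gives \<open>r p = p\<close>.\<close>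

lemma orthogonal_projector_comp_commute:
  assumes p: "orthogonal_projector p" and r: "orthogonal_projector r" and pr: "\<And>x. p (r x) = p x"
  shows "r (p x) = p x"
proof -
  have "inner (r (p x)) y = inner (p x) y" for y
    using pr[of y] p r by (simp add: orthogonal_projector_self_adjoint)
  then have "inner (r (p x) - p x) y = 0" for y by (simp add: inner_diff_left)
  from this[of "r (p x) - p x"] show ?thesis by simp
qed

text \<open>The hypothesis \<open>p r p = r p\<close> says that \<open>r\<close> leaves the range of
  \<open>p\<close> invariant. Its left side is self-adjoint, so \<open>r p\<close> equals its
  adjoint \<open>p r\<close>.\<close>

lemma orthogonal_projector_swap:
  assumes p: "orthogonal_projector p" and r: "orthogonal_projector r"
    and inv: "\<And>x. p (r (p x)) = r (p x)"
  shows "p (r x) = r (p x)"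
proof -
  have "inner (p (r x)) y = inner (r (p x)) y" for y
  proof -
    have "inner (p (r x)) y = inner x (r (p y))"
      by (simp only: orthogonal_projector_self_adjoint[OF p] orthogonal_projector_self_adjoint[OF r])
    also have "\<dots> = inner x (p (r (p y)))" using inv by simp
    also have "\<dots> = inner (p (r (p x))) y"
      by (simp only: orthogonal_projector_self_adjoint[OF p] orthogonal_projector_self_adjoint[OF r])
    finally show ?thesis using inv by simp
  qed
  then have "inner (p (r x) - r (p x)) y = 0" for y by (simp add: inner_diff_left)
  from this[of "p (r x) - r (p x)"] show ?thesis by simp
qed

text \<open>Squared increments of \<open>f\<close> are dominated by increments of the bounded
  function \<open>g\<close>, so \<open>f\<close> varies little once \<open>g\<close> is close to its
  supremum. Stated for an arbitrary filter, this serves partitions under refinement as well as times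
  tending to infinity; \<open>D\<close> collects the indices at which the estimate is
  available.\<close>

lemma orthogonal_increments_convergent:
  fixes f :: "'b \<Rightarrow> 'a::{real_normed_vector,complete_space}" and g :: "'b \<Rightarrow> real"
  assumes ne: "D \<noteq> {}" and bot: "\<F> \<noteq> bot"
    and inc: "\<And>x. x \<in> D \<Longrightarrow> \<forall>\<^sub>F y in \<F>. y \<in> D \<and> (norm (f y - f x))\<^sup>2 \<le> g y - g x"
    and bnd: "\<And>x. x \<in> D \<Longrightarrow> g x \<le> B"
  shows "\<exists>l. (f \<longlongrightarrow> l) \<F>"
proof -
  define L where "L = Sup (g ` D)"
  have bdd: "bdd_above (g ` D)" using bnd by (auto intro!: bdd_aboveI)
  have gL: "g x \<le> L" if "x \<in> D" for x
    unfolding L_def using that by (intro cSup_upper bdd) auto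
  have "cauchy_filter (filtermap f \<F>)"
    unfolding cauchy_filter_metric_filtermap
  proof (intro allI impI)
    fix e :: real assume e: "0 < e"
    \<comment> \<open>Eventually \<open>f\<close> stays within \<open>e/2\<close> of its value at an
      index where \<open>g\<close> is within \<open>(e/2)\<^sup>2\<close> of its supremum.\<close>
    have "\<exists>x\<in>D. L - (e/2)\<^sup>2 < g x"
      using less_cSupE[of "L - (e/2)\<^sup>2" "g ` D"] ne e unfolding L_def by auto
    then obtain x where x: "x \<in> D" "L - (e/2)\<^sup>2 < g x" by blast
    have near: "norm (f y - f x) < e/2" if "y \<in> D \<and> (norm (f y - f x))\<^sup>2 \<le> g y - g x" for y
    proof -
      have "(norm (f y - f x))\<^sup>2 < (e/2)\<^sup>2" using that gL[of y] x(2) by linarith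
      then show ?thesis by (rule power2_less_imp_less) (use e in simp)
    qed
    show "\<exists>P. eventually P \<F> \<and> (\<forall>y z. P y \<and> P z \<longrightarrow> dist (f y) (f z) < e)"
    proof (intro exI conjI allI impI)
      show "\<forall>\<^sub>F y in \<F>. y \<in> D \<and> (norm (f y - f x))\<^sup>2 \<le> g y - g x" by (rule inc[OF x(1)])
      fix y z assume yz: "(y \<in> D \<and> (norm (f y - f x))\<^sup>2 \<le> g y - g x) \<and>
        (z \<in> D \<and> (norm (f z - f x))\<^sup>2 \<le> g z - g x)"
      have "dist (f y) (f x) < e/2" "dist (f z) (f x) < e/2"
        using yz near unfolding dist_norm by blast+
      then show "dist (f y) (f z) < e" by (rule dist_triangle_half_l)
    qed
  qed
  then have "\<exists>c. filtermap f \<F> \<le> nhds c"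
    by (rule cauchy_filter_complete_converges[OF _ complete_UNIV]) (use bot in \<open>auto simp: filtermap_bot_iff\<close>)
  then show ?thesis by (simp add: filterlim_def)
qed

section \<open>Sums over partitions\<close>

lemma partition_sum_singleton: "partition_sum f {a} = 0"
  by (simp add: partition_sum_def)

text \<open>The new maximum is appended at the end of the sorted list, so the earlier summands stay
  in place. This is the recursion for inductions that add the largest point of a partition.\<close>

lemma partition_sum_insert:
  assumes fin: "finite \<theta>" and ne: "\<theta> \<noteq> {}" and lt: "\<And>s. s \<in> \<theta> \<Longrightarrow> s < t"
  shows "partition_sum f (insert t \<theta>) = partition_sum f \<theta> + f (Max \<theta>) t"
proof -
  define xs where "xs = sorted_list_of_set \<theta>"
  have tn: "t \<notin> \<theta>" using lt by blast
  have set: "set xs = \<theta>" and srt: "sorted xs" using fin by (auto simp: xs_def)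
  have ins: "sorted_list_of_set (insert t \<theta>) = xs @ [t]"
    using fin tn set srt lt by (auto simp: xs_def[symmetric] less_imp_le intro!: sorted_insort_is_snoc)
  have xs: "xs \<noteq> []" using ne set by auto
  have "last xs = Max \<theta>"
  proof (rule Max_eqI[symmetric])
    show "finite \<theta>" "last xs \<in> \<theta>" using fin xs set by auto
    fix y assume "y \<in> \<theta>"
    then obtain i where "i < length xs" "y = xs ! i" using set by (auto simp: in_set_conv_nth)
    then show "y \<le> last xs" using srt xs by (auto simp: last_conv_nth sorted_iff_nth_mono)
  qed
  then have mx: "xs ! (length xs - 1) = Max \<theta>" using xs by (simp add: last_conv_nth)
  have "partition_sum f (insert t \<theta>)
      = (\<Sum>i = 1..<Suc (length xs). f ((xs @ [t]) ! (i - 1)) ((xs @ [t]) ! i))"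
    by (simp add: partition_sum_def ins Let_def)
  also have "\<dots> = (\<Sum>i = 1..<length xs. f ((xs @ [t]) ! (i - 1)) ((xs @ [t]) ! i))
      + f ((xs @ [t]) ! (length xs - 1)) ((xs @ [t]) ! length xs)"
    using xs by (subst sum.atLeastLessThan_Suc) (auto simp: Suc_le_eq)
  also have "(\<Sum>i = 1..<length xs. f ((xs @ [t]) ! (i - 1)) ((xs @ [t]) ! i)) = partition_sum f \<theta>"
    unfolding partition_sum_def xs_def[symmetric] Let_def
    by (rule sum.cong) (auto simp: nth_append)
  also have "f ((xs @ [t]) ! (length xs - 1)) ((xs @ [t]) ! length xs) = f (Max \<theta>) t"
    using xs mx by (simp add: nth_append)
  finally show ?thesis .
qed

text \<open>Used to move partitions along the embedding of real times into extended real times. Only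
  points in increasing order are paired in the sum, so agreement for \<open>s < t\<close> is
  enough.\<close>

lemma partition_sum_image:
  fixes h :: "'s::linorder \<Rightarrow> 't::linorder"
  assumes "finite \<theta>" "strict_mono_on \<theta> h"
    and "\<And>s t. s \<in> \<theta> \<Longrightarrow> t \<in> \<theta> \<Longrightarrow> s < t \<Longrightarrow> f (h s) (h t) = g s t"
  shows "partition_sum f (h ` \<theta>) = partition_sum g \<theta>"
  using assms
proof (induction \<theta> rule: finite_linorder_max_induct)
  case empty
  then show ?case by (simp add: partition_sum_def)
next
  case (insert t \<theta>)
  have sm: "strict_mono_on \<theta> h" using insert.prems(1) by (auto simp: strict_mono_on_def)
  have IH: "partition_sum f (h ` \<theta>) = partition_sum g \<theta>"
    using insert.IH sm insert.prems(2) by blast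
  show ?case
  proof (cases "\<theta> = {}")
    case True
    then show ?thesis by (simp add: partition_sum_singleton)
  next
    case False
    have mt: "Max \<theta> \<in> \<theta>" using False insert.hyps(1) by simp
    have "mono_on \<theta> h" using sm by (rule strict_mono_on_imp_mono_on)
    then have mx: "Max (h ` \<theta>) = h (Max \<theta>)"
      using insert.hyps(1) mt by (intro Max_eqI) (auto elim!: monotone_onD)
    have "partition_sum f (h ` insert t \<theta>) = partition_sum f (insert (h t) (h ` \<theta>))" by simp
    also have "\<dots> = partition_sum f (h ` \<theta>) + f (Max (h ` \<theta>)) (h t)"
      using insert.hyps False insert.prems(1)
      by (intro partition_sum_insert) (auto simp: strict_mono_on_def)
    also have "\<dots> = partition_sum g \<theta> + g (Max \<theta>) t"
      using IH mx insert.prems(2)[of "Max \<theta>" t] mt insert.hyps(2) by auto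
    also have "\<dots> = partition_sum g (insert t \<theta>)"
      using insert.hyps False by (intro partition_sum_insert[symmetric]) auto
    finally show ?thesis .
  qed
qed

section \<open>The time projection as an orthogonal projection\<close>

text \<open>
  The partition operator of \<open>\<theta>\<close> with largest point \<open>u\<close> is the orthogonal projection onto the
  vectors \<open>k\<close> with \<open>Q u k = k\<close> and \<open>Q t k \<in> range (P t)\<close> for \<open>t \<in> \<theta>\<close>. These spaces visibly
  decrease as \<open>\<theta>\<close> refines, so the strong limit is the projection onto their intersection.
\<close>

locale adapted_projectors =
  fixes z :: "'t::linorder" and Q P :: "'t \<Rightarrow> 'a::{real_inner,complete_space} \<Rightarrow> 'a"
  assumes Q_projector: "z \<le> t \<Longrightarrow> orthogonal_projector (Q t)"
    and P_projector: "z \<le> t \<Longrightarrow> orthogonal_projector (P t)"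
    and Q_bottom: "Q z x = 0"
    and Q_Q: "z \<le> s \<Longrightarrow> s \<le> t \<Longrightarrow> Q s (Q t x) = Q s x"
    and P_P: "z \<le> s \<Longrightarrow> s \<le> t \<Longrightarrow> P s (P t x) = P s x"
    and P_Q_commute: "z \<le> s \<Longrightarrow> s \<le> t \<Longrightarrow> P t (Q s x) = Q s (P t x)"
begin

lemma Q_Q': "z \<le> s \<Longrightarrow> s \<le> t \<Longrightarrow> Q t (Q s x) = Q s x"
  by (rule orthogonal_projector_comp_commute) (auto intro: Q_projector order_trans Q_Q)

lemma P_P': "z \<le> s \<Longrightarrow> s \<le> t \<Longrightarrow> P t (P s x) = P s x"
  by (rule orthogonal_projector_comp_commute) (auto intro: P_projector order_trans P_P)

lemma linear_Q: "z \<le> t \<Longrightarrow> linear (Q t)"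
  using Q_projector by (simp add: orthogonal_projector_def)

lemma linear_P: "z \<le> t \<Longrightarrow> linear (P t)"
  using P_projector by (simp add: orthogonal_projector_def)

lemmas Q_linear_simps = linear_add[OF linear_Q] linear_diff[OF linear_Q] linear_scale[OF linear_Q]
  linear_0[OF linear_Q]
lemmas P_linear_simps = linear_add[OF linear_P] linear_diff[OF linear_P] linear_scale[OF linear_P]
  linear_0[OF linear_P]
lemmas Q_self_adjoint = orthogonal_projector_self_adjoint[OF Q_projector]
lemmas P_self_adjoint = orthogonal_projector_self_adjoint[OF P_projector]

lemma tendsto_Q: "z \<le> t \<Longrightarrow> (f \<longlongrightarrow> l) \<F> \<Longrightarrow> ((\<lambda>x. Q t (f x)) \<longlongrightarrow> Q t l) \<F>"
  by (rule bounded_linear.tendsto[OF orthogonal_projector_bounded_linear[OF Q_projector]])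

lemma tendsto_P: "z \<le> t \<Longrightarrow> (f \<longlongrightarrow> l) \<F> \<Longrightarrow> ((\<lambda>x. P t (f x)) \<longlongrightarrow> P t l) \<F>"
  by (rule bounded_linear.tendsto[OF orthogonal_projector_bounded_linear[OF P_projector]])

definition partition_op :: "'t set \<Rightarrow> 'a \<Rightarrow> 'a" where
  "partition_op \<theta> x = partition_sum (\<lambda>s t. Q t (P t x) - Q s (P t x)) \<theta>"

text \<open>Membership of \<open>Q t k\<close> in the range of \<open>P t\<close>, written as a
  fixed-point equation so that it passes to norm limits.\<close>

definition adapted_on :: "'t set \<Rightarrow> 'a \<Rightarrow> bool" where
  "adapted_on \<theta> k \<longleftrightarrow> (\<forall>t\<in>\<theta>. P t (Q t k) = Q t k)"

text \<open>Induction on the largest point of \<open>\<theta>\<close>. The clause on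
  \<open>P (Max \<theta>)\<close> is what makes the old sum invariant under \<open>P\<close> at the
  next point. The last clause contains the orthogonality of the error to adapted vectors fixed by
  \<open>Q (Max \<theta>)\<close>; it is stated for all adapted \<open>k\<close>, since a
  \<open>k\<close> fixed by \<open>Q\<close> at the next point need not be fixed at the present
  one.\<close>

lemma partition_op_projection:
  assumes "finite \<theta>" "z \<in> \<theta>" "\<theta> \<subseteq> {z..}"
  shows "Q (Max \<theta>) (partition_op \<theta> x) = partition_op \<theta> x \<and>
         P (Max \<theta>) (partition_op \<theta> x) = partition_op \<theta> x \<and>
         adapted_on \<theta> (partition_op \<theta> x) \<and>
         (\<forall>k. adapted_on \<theta> k \<longrightarrow> inner (partition_op \<theta> x) k = inner x (Q (Max \<theta>) k))"
  using assms
proof (induction \<theta> rule: finite_linorder_max_induct)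
  case empty
  then show ?case by simp
next
  case (insert t \<theta>)
  show ?case
  proof (cases "\<theta> = {}")
    case True
    \<comment> \<open>The sum over a single point is empty, in accordance with \<open>Q z\<close>
      being zero.\<close>
    with insert.prems have "t = z" by simp
    then show ?thesis using True
      by (simp add: partition_op_def partition_sum_singleton adapted_on_def Q_bottom P_linear_simps)
  next
    case False
    define m where "m = Max \<theta>"
    define y where "y = partition_op \<theta> x"
    have m: "m \<in> \<theta>" using False insert.hyps(1) by (simp add: m_def)
    have mt: "m < t" "m \<le> t" using m insert.hyps(2) by auto
    have zm: "z \<le> m" using m insert.prems(2) by auto
    have zt: "z \<le> t" using zm mt by simp
    have "z \<noteq> t" using zm mt by auto
    then have "z \<in> \<theta>" using insert.prems(1) by auto
    with insert.IH insert.prems(2)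
    have IH: "Q m y = y" "P m y = y" "adapted_on \<theta> y"
      "\<And>k. adapted_on \<theta> k \<Longrightarrow> inner y k = inner x (Q m k)"
      by (auto simp: y_def m_def)
    have mx: "Max (insert t \<theta>) = t"
      using insert.hyps by (intro Max_eqI) (auto intro: less_imp_le)
    define y' where "y' = partition_op (insert t \<theta>) x"
    have y': "y' = y + (Q t (P t x) - Q m (P t x))"
      unfolding y'_def y_def m_def partition_op_def
      by (rule partition_sum_insert) (use insert.hyps False in auto)
    have "Q t y = y" using Q_Q'[OF zm mt(2), of y] IH(1) by simp
    then have 1: "Q t y' = y'"
      using zm zt mt by (simp add: y' Q_linear_simps Q_Q' )
    have "P t y = y" using P_P'[OF zm mt(2), of y] IH(2) by simp
    then have 2: "P t y' = y'"
      using zm zt mt by (simp add: y' P_linear_simps P_Q_commute P_P)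
    \<comment> \<open>For \<open>s \<le> m\<close> the new summand is annihilated by
      \<open>Q s\<close>, because \<open>Q s Q t = Q s = Q s Q m\<close>.\<close>
    have "P s (Q s y') = Q s y'" if "s \<in> \<theta>" for s
    proof -
      have "z \<le> s" "s \<le> m" "s \<le> t"
        using that insert.prems(2) insert.hyps by (auto simp: m_def intro: less_imp_le)
      then have "Q s y' = Q s y" using zm zt by (simp add: y' Q_linear_simps Q_Q)
      then show ?thesis using IH(3) that by (simp add: adapted_on_def)
    qed
    then have 3: "adapted_on (insert t \<theta>) y'" using 1 2 by (simp add: adapted_on_def)
    \<comment> \<open>Self-adjointness moves all operators to \<open>k\<close>, where adaptedness
      removes \<open>P t\<close>. The new summand contributes
      \<open>inner x (Q t k - Q m k)\<close>, which telescopes with the induction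
      hypothesis.\<close>
    have "inner y' k = inner x (Q t k)" if k: "adapted_on (insert t \<theta>) k" for k
    proof -
      have kt: "P t (Q t k) = Q t k" and km: "P m (Q m k) = Q m k" and k\<theta>: "adapted_on \<theta> k"
        using k m by (auto simp: adapted_on_def)
      have "P t (Q m k) = Q m k" using P_P'[OF zm mt(2), of "Q m k"] km by simp
      then show ?thesis using IH(4)[OF k\<theta>] kt zm zt
        by (simp add: y' inner_add_left inner_diff_left Q_self_adjoint P_self_adjoint)
    qed
    then show ?thesis using 1 2 3 unfolding mx y'_def by blast
  qed
qed

section \<open>The strong limit over all partitions\<close>

definition adapted_subspace :: "'t \<Rightarrow> 'a set" where
  "adapted_subspace u = {k. Q u k = k \<and> adapted_on {z..u} k}"

lemma subspace_adapted_subspace: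
  assumes "z \<le> u"
  shows "subspace (adapted_subspace u)"
  using assms
  by (auto simp: subspace_def adapted_subspace_def adapted_on_def Q_linear_simps P_linear_simps)

definition time_projection :: "'t \<Rightarrow> 'a \<Rightarrow> 'a" where
  "time_projection u x = Lim (finite_subsets_at_top {z..u}) (\<lambda>\<theta>. partition_op \<theta> x)"

text \<open>The squared norms of \<open>partition_op \<theta> x\<close> decrease under refinement,
  and \<open>orthogonal_increments_convergent\<close> yields a limit. The conditions defining
  \<open>adapted_subspace\<close> and the orthogonality relation are closed, hence inherited by
  it.\<close>

lemma partition_op_convergent:
  assumes u: "z \<le> u"
  shows "\<exists>y. ((\<lambda>\<theta>. partition_op \<theta> x) \<longlongrightarrow> y) (finite_subsets_at_top {z..u})
           \<and> y \<in> adapted_subspace u \<and> (\<forall>k\<in>adapted_subspace u. inner (x - y) k = 0)"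
proof -
  define F where "F = finite_subsets_at_top {z..u}"
  define M where "M = (\<lambda>\<theta>. partition_op \<theta> x)"
  define D where "D = {\<theta>. finite \<theta> \<and> \<theta> \<subseteq> {z..u} \<and> z \<in> \<theta> \<and> u \<in> \<theta>}"
  have bot: "F \<noteq> bot" by (simp add: F_def)
  \<comment> \<open>The filter runs over all finite subsets of \<open>{z..u}\<close>; adjoining both
    endpoints to \<open>\<theta>0\<close> shows that membership in \<open>D\<close> holds
    eventually.\<close>
  have ev: "\<forall>\<^sub>F \<theta> in F. \<theta> \<in> D \<and> \<theta>0 \<subseteq> \<theta>" if "\<theta>0 \<subseteq> {z..u}" "finite \<theta>0" for \<theta>0
    unfolding F_def eventually_finite_subsets_at_top
    by (rule exI[of _ "insert z (insert u \<theta>0)"]) (use that u in \<open>auto simp: D_def\<close>)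
  have M: "Q u (M \<theta>) = M \<theta>" "adapted_on \<theta> (M \<theta>)"
      "\<And>k. adapted_on \<theta> k \<Longrightarrow> inner (M \<theta>) k = inner x (Q u k)" if "\<theta> \<in> D" for \<theta>
  proof -
    have "Max \<theta> = u" using that by (intro Max_eqI) (auto simp: D_def)
    moreover have "\<theta> \<subseteq> {z..}" using that by (auto simp: D_def)
    ultimately show "Q u (M \<theta>) = M \<theta>" "adapted_on \<theta> (M \<theta>)"
      "\<And>k. adapted_on \<theta> k \<Longrightarrow> inner (M \<theta>) k = inner x (Q u k)"
      using partition_op_projection[of \<theta> x] that by (auto simp: M_def D_def)
  qed
  \<comment> \<open>Pythagoras: \<open>M \<theta>'\<close> is adapted to the coarser
    \<open>\<theta>\<close> too and serves as test vector for both operators. The minus signs turn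
    decreasing norms into an increasing \<open>g\<close>.\<close>
  have dec: "(norm (M \<theta>' - M \<theta>))\<^sup>2 = - (norm (M \<theta>'))\<^sup>2 - - (norm (M \<theta>))\<^sup>2"
    if "\<theta> \<in> D" "\<theta>' \<in> D" "\<theta> \<subseteq> \<theta>'" for \<theta> \<theta>'
  proof -
    have a: "adapted_on \<theta> (M \<theta>')" using M(2)[OF that(2)] that(3) by (auto simp: adapted_on_def)
    have "inner (M \<theta>) (M \<theta>') = inner x (M \<theta>')" "inner (M \<theta>') (M \<theta>') = inner x (M \<theta>')"
      using M(3)[OF that(1) a] M(3)[OF that(2) M(2)[OF that(2)]] M(1)[OF that(2)] by auto
    then show ?thesis
      by (simp add: power2_norm_eq_inner inner_diff_left inner_diff_right inner_commute)
  qed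
  have "\<exists>y. (M \<longlongrightarrow> y) F"
  proof (rule orthogonal_increments_convergent[where D=D and g="\<lambda>\<theta>. - (norm (M \<theta>))\<^sup>2" and B=0])
    have "{z, u} \<in> D" using u by (simp add: D_def)
    then show "D \<noteq> {}" by blast
    show "\<forall>\<^sub>F \<theta>' in F. \<theta>' \<in> D \<and> (norm (M \<theta>' - M \<theta>))\<^sup>2 \<le> - (norm (M \<theta>'))\<^sup>2 - - (norm (M \<theta>))\<^sup>2"
      if "\<theta> \<in> D" for \<theta>
    proof -
      have "\<theta> \<subseteq> {z..u}" "finite \<theta>" using that by (auto simp: D_def)
      from ev[OF this] show ?thesis by eventually_elim (use that dec in auto)
    qed
  qed (auto simp: bot)
  then obtain y where y: "(M \<longlongrightarrow> y) F" ..
  have evD: "\<forall>\<^sub>F \<theta> in F. \<theta> \<in> D" using ev[of "{}"] by simp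
  have "Q u y = y"
  proof (rule tendsto_unique[OF bot])
    show "((\<lambda>\<theta>. Q u (M \<theta>)) \<longlongrightarrow> Q u y) F" by (rule tendsto_Q[OF u y])
    have "\<forall>\<^sub>F \<theta> in F. M \<theta> = Q u (M \<theta>)" using evD by eventually_elim (simp add: M(1))
    then show "((\<lambda>\<theta>. Q u (M \<theta>)) \<longlongrightarrow> y) F" using y by (simp cong: filterlim_cong add: tendsto_cong)
  qed
  moreover have "P t (Q t y) = Q t y" if t: "t \<in> {z..u}" for t
  proof (rule tendsto_unique[OF bot])
    have zt: "z \<le> t" using t by simp
    show "((\<lambda>\<theta>. Q t (M \<theta>)) \<longlongrightarrow> Q t y) F" by (rule tendsto_Q[OF zt y])
    have "((\<lambda>\<theta>. P t (Q t (M \<theta>))) \<longlongrightarrow> P t (Q t y)) F" by (intro tendsto_P tendsto_Q zt y)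
    \<comment> \<open>Once \<open>t\<close> belongs to \<open>\<theta>\<close>, adaptedness of
      \<open>M \<theta>\<close> includes the condition at \<open>t\<close>.\<close>
    moreover have "\<forall>\<^sub>F \<theta> in F. P t (Q t (M \<theta>)) = Q t (M \<theta>)"
      using ev[of "{t}"] t by (auto elim!: eventually_mono dest: M(2) simp: adapted_on_def)
    ultimately show "((\<lambda>\<theta>. Q t (M \<theta>)) \<longlongrightarrow> P t (Q t y)) F" by (rule Lim_transform_eventually)
  qed
  ultimately have "y \<in> adapted_subspace u" by (simp add: adapted_subspace_def adapted_on_def)
  moreover have "inner (x - y) k = 0" if k: "k \<in> adapted_subspace u" for k
  proof -
    have "inner y k = inner x k"
    proof (rule tendsto_unique[OF bot])
      show "((\<lambda>\<theta>. inner (M \<theta>) k) \<longlongrightarrow> inner y k) F" by (intro tendsto_intros y)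
      have "\<forall>\<^sub>F \<theta> in F. inner x k = inner (M \<theta>) k"
        using evD
      proof eventually_elim
        fix \<theta> assume \<theta>: "\<theta> \<in> D"
        then have "adapted_on \<theta> k" "Q u k = k"
          using k by (auto simp: D_def adapted_on_def adapted_subspace_def)
        then show "inner x k = inner (M \<theta>) k" using M(3)[OF \<theta>, of k] by simp
      qed
      then show "((\<lambda>\<theta>. inner (M \<theta>) k) \<longlongrightarrow> inner x k) F"
        by (rule Lim_transform_eventually[OF tendsto_const])
    qed
    then show ?thesis by (simp add: inner_diff_left)
  qed
  ultimately show ?thesis using y unfolding F_def M_def by blast
qed

lemma
  assumes u: "z \<le> u"
  shows tendsto_time_projection:
      "((\<lambda>\<theta>. partition_op \<theta> x) \<longlongrightarrow> time_projection u x) (finite_subsets_at_top {z..u})"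
    and time_projection_in: "time_projection u x \<in> adapted_subspace u"
    and time_projection_orthogonal: "k \<in> adapted_subspace u \<Longrightarrow> inner (x - time_projection u x) k = 0"
proof -
  obtain y where y: "((\<lambda>\<theta>. partition_op \<theta> x) \<longlongrightarrow> y) (finite_subsets_at_top {z..u})"
    "y \<in> adapted_subspace u" "\<And>k. k \<in> adapted_subspace u \<Longrightarrow> inner (x - y) k = 0"
    using partition_op_convergent[OF u] by blast
  have "time_projection u x = y"
    unfolding time_projection_def by (rule tendsto_Lim[OF _ y(1)]) simp
  then show "((\<lambda>\<theta>. partition_op \<theta> x) \<longlongrightarrow> time_projection u x) (finite_subsets_at_top {z..u})"
    "time_projection u x \<in> adapted_subspace u"
    "k \<in> adapted_subspace u \<Longrightarrow> inner (x - time_projection u x) k = 0"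
    using y by auto
qed

section \<open>Compatibility of time projections with the two families of projectors\<close>

lemma time_projection_eqI:
  assumes "z \<le> u" "y \<in> adapted_subspace u"
    and "\<And>k. k \<in> adapted_subspace u \<Longrightarrow> inner (x - y) k = 0"
  shows "time_projection u x = y"
  using subspace_adapted_subspace[OF assms(1)] time_projection_in[OF assms(1)] assms(2)
    time_projection_orthogonal[OF assms(1)] assms(3)
  by (rule projection_unique)

text \<open>\<open>Q u\<close> maps \<open>adapted_subspace v\<close> into
  \<open>adapted_subspace u\<close>. Conversely \<open>adapted_subspace u\<close> is contained in
  \<open>adapted_subspace v\<close>, so the orthogonality known for the larger space can be tested
  on the smaller one.\<close>

lemma Q_time_projection:
  assumes zu: "z \<le> u" and uv: "u \<le> v"
  shows "Q u (time_projection v x) = time_projection u x"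
proof (rule time_projection_eqI[OF zu, symmetric])
  have zv: "z \<le> v" using zu uv by simp
  let ?y = "time_projection v x"
  have y: "adapted_on {z..v} ?y" using time_projection_in[OF zv] by (simp add: adapted_subspace_def)
  have "Q t (Q u ?y) = Q t ?y" if "t \<in> {z..u}" for t using that by (simp add: Q_Q)
  then show "Q u ?y \<in> adapted_subspace u"
    using y zu uv by (auto simp: adapted_subspace_def adapted_on_def Q_Q)
  fix k assume k: "k \<in> adapted_subspace u"
  then have Qk: "Q u k = k" and Pk: "\<And>t. t \<in> {z..u} \<Longrightarrow> P t (Q t k) = Q t k"
    by (auto simp: adapted_subspace_def adapted_on_def)
  \<comment> \<open>A vector fixed by both \<open>Q u\<close> and \<open>P u\<close> is fixed by
    \<open>Q t\<close> and \<open>P t\<close> at every later time.\<close>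
  have late: "P t (Q t k) = Q t k" "Q t k = k" if "u \<le> t" for t
  proof -
    show 1: "Q t k = k" using Q_Q'[OF zu that, of k] Qk by simp
    have "P u k = k" using Pk[of u] Qk zu by simp
    then show "P t (Q t k) = Q t k" using P_P'[OF zu that, of k] 1 by simp
  qed
  have "P t (Q t k) = Q t k" if "t \<in> {z..v}" for t
    using that Pk[of t] late(1)[of t] by (cases "t \<le> u") auto
  then have "k \<in> adapted_subspace v"
    using uv late by (simp add: adapted_subspace_def adapted_on_def)
  then have "inner (x - ?y) k = 0" by (rule time_projection_orthogonal[OF zv])
  then show "inner (x - Q u ?y) k = 0" using Qk zu by (simp add: inner_diff_left Q_self_adjoint)
qed

text \<open>\<open>P s\<close> maps \<open>adapted_subspace v\<close> into itself, and by
  self-adjointness it then commutes with the projection onto that space. \<open>Qv\<close> settles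
  the condition \<open>Q v (P s k) = P s k\<close>, for \<open>Q v\<close> and \<open>P s\<close>
  need not commute when \<open>s < v\<close>.\<close>

lemma P_time_projection:
  assumes zs: "z \<le> s" and sv: "s \<le> v" and Qv: "\<And>x. Q v x = x"
  shows "P s (time_projection v x) = time_projection v (P s x)"
proof (rule time_projection_eqI[symmetric])
  show zv: "z \<le> v" using zs sv by simp
  have inv: "P s k \<in> adapted_subspace v" if k: "k \<in> adapted_subspace v" for k
  proof -
    have kt: "P t (Q t k) = Q t k" if "t \<in> {z..v}" for t
      using that k by (auto simp: adapted_subspace_def adapted_on_def)
    have "P t (Q t (P s k)) = Q t (P s k)" if t: "t \<in> {z..v}" for t
    proof (cases "t \<le> s")
      case True
      \<comment> \<open>Up to time \<open>s\<close>, \<open>Q t\<close> commutes with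
        \<open>P s\<close>, and \<open>Q t k\<close> lies in the range of \<open>P t\<close>, on
        which \<open>P s\<close> acts as the identity.\<close>
      have "Q t (P s k) = P s (Q t k)" using True t by (simp add: P_Q_commute)
      also have "\<dots> = P s (P t (Q t k))" using kt[OF t] by simp
      also have "\<dots> = Q t k" using P_P'[of t s "Q t k"] kt[OF t] True t by simp
      finally show ?thesis using kt[OF t] by simp
    next
      case False
      \<comment> \<open>After time \<open>s\<close>, the vector \<open>P s k\<close> lies in the
        range of \<open>P t\<close>, which \<open>Q t\<close> leaves invariant.\<close>
      then show ?thesis using t zs by (simp add: P_Q_commute P_P')
    qed
    then show ?thesis using Qv by (simp add: adapted_subspace_def adapted_on_def)
  qed
  show "P s (time_projection v x) \<in> adapted_subspace v"
    by (intro inv time_projection_in zv)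
  fix k assume "k \<in> adapted_subspace v"
  from time_projection_orthogonal[OF zv inv[OF this]]
  show "inner (P s x - P s (time_projection v x)) k = 0"
    using zs by (simp add: P_self_adjoint inner_diff_left)
qed

end

section \<open>Operators on complex Hilbert spaces\<close>

lemma Re_cinner: "Re (cinner x y) = inner x y"
  by (simp add: inner_eq_Re_cinner)

text \<open>The second argument is antilinear, so \<open>\<i>\<close> comes out as
  \<open>- \<i>\<close>. Together with \<open>Re_cinner\<close> this derives complex identities from
  real ones for sets and maps compatible with multiplication by \<open>\<i>\<close>.\<close>

lemma Im_cinner: "Im (cinner x y) = inner x (\<i> *\<^sub>C y)"
proof -
  have "cinner x (\<i> *\<^sub>C y) = cnj (\<i> * cinner y x)"
    by (metis cinner_commute cinner_scaleC_left)
  also have "\<dots> = - \<i> * cinner x y" by (metis cinner_commute complex_cnj_i complex_cnj_mult)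
  finally show ?thesis by (simp add: inner_eq_Re_cinner)
qed

lemma cinner_self_real: "cinner x x \<in> \<real>"
  using cinner_commute[of x x] by (simp add: Reals_cnj_iff)

lemma norm_scaleC: "norm (c *\<^sub>C x) = cmod c * norm (x::'h::complex_hilbert_space)"
proof -
  have "cinner (c *\<^sub>C x) (c *\<^sub>C x) = c * (cnj c * cnj (cinner x x))"
    by (metis cinner_commute cinner_scaleC_left complex_cnj_mult)
  also have "\<dots> = (cmod c)\<^sup>2 * cinner x x"
    by (metis cinner_commute complex_norm_square mult.assoc)
  finally have "(norm (c *\<^sub>C x))\<^sup>2 = (cmod c * norm x)\<^sup>2"
    by (simp add: power2_norm_eq_inner inner_eq_Re_cinner power_mult_distrib flip: of_real_power)
  then show ?thesis by simp
qed

lemma scaleC_scaleR_commute: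
  "c *\<^sub>C (r *\<^sub>R x) = r *\<^sub>R (c *\<^sub>C (x::'h::complex_hilbert_space))"
  by (simp add: scaleR_eq_scaleC scaleC_scaleC mult.commute)

lemma bounded_linear_scaleC: "bounded_linear (\<lambda>x::'h::complex_hilbert_space. c *\<^sub>C x)"
  by (rule bounded_linear_intro[where K="cmod c"])
    (auto simp: scaleC_add_right scaleC_scaleR_commute norm_scaleC)

section \<open>Bounded complex-linear operators and commutants\<close>

lemma bounded_clinear_linear: "bounded_clinear a \<Longrightarrow> linear a"
  by (simp add: bounded_clinear_def bounded_linear.linear)

lemma bounded_clinear_scaleC: "bounded_clinear a \<Longrightarrow> a (c *\<^sub>C x) = c *\<^sub>C a x"
  by (simp add: bounded_clinear_def)

lemma bounded_clinear_0: "bounded_clinear (\<lambda>x. 0)"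
  by (simp add: bounded_clinear_def bounded_linear_zero
      linear_0[OF bounded_linear.linear[OF bounded_linear_scaleC]])

lemma bounded_clinear_add:
  "bounded_clinear a \<Longrightarrow> bounded_clinear b \<Longrightarrow> bounded_clinear (\<lambda>x. a x + b x)"
  by (simp add: bounded_clinear_def bounded_linear_add scaleC_add_right)

lemma bounded_clinear_diff:
  "bounded_clinear a \<Longrightarrow> bounded_clinear b \<Longrightarrow> bounded_clinear (\<lambda>x. a x - b x)"
  by (simp add: bounded_clinear_def bounded_linear_sub
      linear_diff[OF bounded_linear.linear[OF bounded_linear_scaleC]])

lemma bounded_clinear_scale:
  "bounded_clinear a \<Longrightarrow> bounded_clinear (\<lambda>x. c *\<^sub>C a x)"
  by (simp add: bounded_clinear_def bounded_linear_compose[OF bounded_linear_scaleC] scaleC_scaleC mult.commute)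

lemma bounded_clinear_comp:
  "bounded_clinear a \<Longrightarrow> bounded_clinear b \<Longrightarrow> bounded_clinear (a \<circ> b)"
  by (simp add: bounded_clinear_def bounded_linear_compose comp_def)

lemma
  assumes S: "\<And>a. a \<in> S \<Longrightarrow> bounded_clinear a"
  shows commutant_0: "(\<lambda>x. 0) \<in> commutant S"
    and commutant_add: "b \<in> commutant S \<Longrightarrow> c \<in> commutant S \<Longrightarrow> (\<lambda>x. b x + c x) \<in> commutant S"
    and commutant_scale: "b \<in> commutant S \<Longrightarrow> (\<lambda>x. w *\<^sub>C b x) \<in> commutant S"
    and commutant_comp: "b \<in> commutant S \<Longrightarrow> c \<in> commutant S \<Longrightarrow> b \<circ> c \<in> commutant S"
  using S
  by (auto simp: commutant_def fun_eq_iff bounded_clinear_0 bounded_clinear_add bounded_clinear_scale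
      bounded_clinear_comp linear_0[OF bounded_clinear_linear] linear_add[OF bounded_clinear_linear]
      bounded_clinear_scaleC)

section \<open>Complex subspaces and orbit closures\<close>

definition csubspace :: "'h::complex_hilbert_space set \<Rightarrow> bool" where
  "csubspace S \<longleftrightarrow> subspace S \<and> (\<forall>c. \<forall>x\<in>S. c *\<^sub>C x \<in> S)"

lemma subspace_closure:
  fixes S :: "'a::real_normed_vector set"
  assumes "subspace S"
  shows "subspace (closure S)"
proof -
  have "x + y \<in> closure S" if xy: "x \<in> closure S" "y \<in> closure S" for x y
  proof -
    obtain f g where fg: "\<And>n::nat. f n \<in> S" "f \<longlonglongrightarrow> x" "\<And>n::nat. g n \<in> S" "g \<longlonglongrightarrow> y"
      using xy unfolding closure_sequential by blast
    have "(\<lambda>n. f n + g n) \<longlonglongrightarrow> x + y" by (intro tendsto_add fg)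
    moreover have "f n + g n \<in> S" for n using assms fg by (intro subspace_add)
    ultimately show ?thesis unfolding closure_sequential
      by (intro exI[of _ "\<lambda>n. f n + g n"]) blast
  qed
  moreover have "c *\<^sub>R x \<in> closure S" if "x \<in> closure S" for c x
  proof -
    have "scaleR c ` closure S \<subseteq> closure (scaleR c ` S)"
      by (rule closure_bounded_linear_image_subset[OF bounded_linear_scaleR_right])
    also have "\<dots> \<subseteq> closure S" using assms by (intro closure_mono) (auto simp: subspace_scale)
    finally show ?thesis using that by auto
  qed
  moreover have "0 \<in> closure S" using assms subspace_0 closure_subset by blast
  ultimately show ?thesis by (simp add: subspace_def)
qed

lemma csubspace_closure:
  assumes "csubspace S"
  shows "csubspace (closure S)"
proof -
  have "c *\<^sub>C x \<in> closure S" if "x \<in> closure S" for c x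
  proof -
    have "scaleC c ` closure S \<subseteq> closure (scaleC c ` S)"
      by (rule closure_bounded_linear_image_subset[OF bounded_linear_scaleC])
    also have "\<dots> \<subseteq> closure S" using assms by (intro closure_mono) (auto simp: csubspace_def)
    finally show ?thesis using that by auto
  qed
  then show ?thesis using assms by (simp add: csubspace_def subspace_closure)
qed

text \<open>A von Neumann algebra is its double commutant, hence itself a commutant, and inherits
  zero, sums, multiples and products from the commutant lemmas. Boundedness carries invariance from
  the orbit of \<open>\<Omega>\<close> to its closure.\<close>

lemma
  assumes "von_neumann_algebra A"
  shows csubspace_orbit_closure: "csubspace (closure ((\<lambda>a. a \<Omega>) ` A))"
    and orbit_closure_invariant:
      "a \<in> A \<Longrightarrow> x \<in> closure ((\<lambda>a. a \<Omega>) ` A) \<Longrightarrow> a x \<in> closure ((\<lambda>a. a \<Omega>) ` A)"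
proof -
  have A: "A = commutant (commutant A)" and cl: "\<And>a. a \<in> A \<Longrightarrow> bounded_clinear a"
    using assms by (auto simp: von_neumann_algebra_def)
  have C: "\<And>a. a \<in> commutant A \<Longrightarrow> bounded_clinear a" by (simp add: commutant_def)
  note ops = commutant_0[of "commutant A", OF C, folded A, simplified]
    commutant_add[of "commutant A", OF C, folded A, simplified]
    commutant_scale[of "commutant A", OF C, folded A, simplified]
    commutant_comp[of "commutant A", OF C, folded A, simplified]
  let ?S = "(\<lambda>a. a \<Omega>) ` A"
  have scale: "c *\<^sub>C x \<in> ?S" if x: "x \<in> ?S" for c x
  proof -
    from x obtain a where "a \<in> A" "x = a \<Omega>" by blast
    with ops(3)[of a c] show ?thesis by (auto simp: image_iff intro!: bexI[of _ "\<lambda>y. c *\<^sub>C a y"])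
  qed
  have "x + y \<in> ?S" if xy: "x \<in> ?S" "y \<in> ?S" for x y
  proof -
    from xy obtain a b where "a \<in> A" "b \<in> A" "x = a \<Omega>" "y = b \<Omega>" by blast
    with ops(2)[of a b] show ?thesis by (auto simp: image_iff intro!: bexI[of _ "\<lambda>y. a y + b y"])
  qed
  moreover have "0 \<in> ?S" using ops(1) by (auto simp: image_iff intro!: bexI[of _ "\<lambda>y. 0"])
  ultimately have "csubspace ?S" using scale by (simp add: csubspace_def subspace_def scaleR_eq_scaleC)
  then show "csubspace (closure ?S)" by (rule csubspace_closure)
  assume a: "a \<in> A" and x: "x \<in> closure ?S"
  have "a ` closure ?S \<subseteq> closure (a ` ?S)"
    using cl[OF a] by (intro closure_bounded_linear_image_subset) (simp add: bounded_clinear_def)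
  also have "\<dots> \<subseteq> closure ?S"
  proof (intro closure_mono subsetI)
    fix y assume "y \<in> a ` ?S"
    then obtain b where "b \<in> A" "y = (a \<circ> b) \<Omega>" by auto
    with ops(4)[OF a, of b] show "y \<in> ?S" by blast
  qed
  finally show "a x \<in> closure ?S" using x by blast
qed

text \<open>The real orthogonal projection exists and is unique. As \<open>S\<close> is stable under
  \<open>\<i>\<close>, real orthogonality to \<open>S\<close> is complex orthogonality, so the
  description in \<open>orth_proj\<close> denotes that point.\<close>

lemma
  assumes cl: "closed S" and sub: "csubspace S"
  shows orth_proj_in: "orth_proj S x \<in> S"
    and orth_proj_orthogonal: "y \<in> S \<Longrightarrow> inner (x - orth_proj S x) y = 0"
    and orth_proj_eqI: "z \<in> S \<Longrightarrow> (\<And>y. y \<in> S \<Longrightarrow> inner (x - z) y = 0) \<Longrightarrow> orth_proj S x = z"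
proof -
  have S: "subspace S" and i: "\<And>c x. x \<in> S \<Longrightarrow> c *\<^sub>C x \<in> S"
    using sub by (auto simp: csubspace_def)
  obtain p where p: "p \<in> S" "\<And>z. z \<in> S \<Longrightarrow> inner (x - p) z = 0"
    using closed_subspace_projection_exists[OF cl S] by blast
  have eq: "orth_proj S x = p"
    unfolding orth_proj_def
  proof (rule the_equality)
    show "p \<in> S \<and> (\<forall>z\<in>S. cinner (x - p) z = 0)"
      using p i by (auto simp: complex_eq_iff Re_cinner Im_cinner)
    fix y assume y: "y \<in> S \<and> (\<forall>z\<in>S. cinner (x - y) z = 0)"
    then have "\<And>z. z \<in> S \<Longrightarrow> inner (x - y) z = 0" by (simp add: inner_eq_Re_cinner)
    then show "y = p" using y p by (intro projection_unique[OF S]) auto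
  qed
  show "orth_proj S x \<in> S" "y \<in> S \<Longrightarrow> inner (x - orth_proj S x) y = 0" using p eq by auto
  show "orth_proj S x = z" if "z \<in> S" "\<And>y. y \<in> S \<Longrightarrow> inner (x - z) y = 0"
    using projection_unique[OF S p(1) that(1) p(2) that(2)] eq by simp
qed

lemma orth_proj_fixes: "closed S \<Longrightarrow> csubspace S \<Longrightarrow> x \<in> S \<Longrightarrow> orth_proj S x = x"
  by (rule orth_proj_eqI) auto

lemma orthogonal_projector_orth_proj:
  assumes S: "closed S" "csubspace S"
  shows "orthogonal_projector (orth_proj S)"
proof -
  let ?p = "orth_proj S"
  have sub: "subspace S" using S(2) by (simp add: csubspace_def)
  note orth = orth_proj_orthogonal[OF S]
  have "?p (x + y) = ?p x + ?p y" for x y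
  proof (rule orth_proj_eqI[OF S])
    show "?p x + ?p y \<in> S" by (intro subspace_add[OF sub] orth_proj_in S)
    show "inner (x + y - (?p x + ?p y)) z = 0" if "z \<in> S" for z
      using orth[OF that, of x] orth[OF that, of y]
      by (simp add: inner_diff_left inner_add_left)
  qed
  moreover have "?p (c *\<^sub>R x) = c *\<^sub>R ?p x" for c x
  proof (rule orth_proj_eqI[OF S])
    show "c *\<^sub>R ?p x \<in> S" by (intro subspace_scale[OF sub] orth_proj_in S)
    show "inner (c *\<^sub>R x - c *\<^sub>R ?p x) z = 0" if "z \<in> S" for z
      using orth[OF that, of x] by (simp add: inner_diff_left)
  qed
  ultimately have "linear ?p" by (rule linearI)
  moreover have "inner (?p x) y = inner x (?p y)" for x y
    using orth[OF orth_proj_in[OF S], of x y] orth[OF orth_proj_in[OF S], of y x]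
    by (simp add: inner_diff_left inner_diff_right inner_commute[of _ x] inner_commute[of _ y]
        inner_commute[of "?p y"])
  ultimately show ?thesis
    by (simp add: orthogonal_projector_def orth_proj_fixes[OF S orth_proj_in[OF S]])
qed

lemma orth_proj_tower:
  assumes S: "closed S" "csubspace S" and S': "closed S'" "csubspace S'" and sub: "S \<subseteq> S'"
  shows "orth_proj S (orth_proj S' x) = orth_proj S x"
proof (rule orth_proj_eqI[OF S, symmetric])
  show "orth_proj S (orth_proj S' x) \<in> S" by (rule orth_proj_in[OF S])
  fix z assume z: "z \<in> S"
  then have "z \<in> S'" using sub by blast
  then show "inner (x - orth_proj S (orth_proj S' x)) z = 0"
    using orth_proj_orthogonal[OF S z, of "orth_proj S' x"] orth_proj_orthogonal[OF S', of z x]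
    by (simp add: inner_diff_left)
qed

section \<open>Projections and the operator order\<close>

lemma projection_orthogonal_projector: "projection p \<Longrightarrow> orthogonal_projector p"
  by (auto simp: projection_def orthogonal_projector_def bounded_clinear_linear inner_eq_Re_cinner
      fun_eq_iff)

text \<open>\<open>orthogonal_projector\<close> concerns the real structure only. The imaginary part
  of complex symmetry is the real symmetry at \<open>\<i> *\<^sub>C y\<close>, and complex
  homogeneity moves \<open>\<i>\<close> through \<open>p\<close>.\<close>

lemma projectionI:
  assumes p: "orthogonal_projector p" and i: "\<And>c x. p (c *\<^sub>C x) = c *\<^sub>C p x"
  shows "projection p"
  using p i unfolding projection_def bounded_clinear_def
  by (auto simp: orthogonal_projector_bounded_linear orthogonal_projector_idem fun_eq_iff
      complex_eq_iff Re_cinner Im_cinner orthogonal_projector_self_adjoint)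

lemma op_le_inner: "op_le a b \<Longrightarrow> inner (a x) x \<le> inner (b x) x"
  by (simp add: op_le_def positive_op_def Re_cinner inner_diff_left)

text \<open>The order is tested on the kernel of \<open>r\<close>: for \<open>y = x - r x\<close> it
  forces \<open>(norm (p y))\<^sup>2 = inner (p y) y \<le> 0\<close>.\<close>

lemma op_le_projection_comp:
  assumes p: "orthogonal_projector p" and r: "orthogonal_projector r" and le: "op_le p r"
  shows "p (r x) = p x"
proof -
  have lin: "linear p" "linear r" using p r by (auto simp: orthogonal_projector_def)
  define y where "y = x - r x"
  have "r y = 0" by (simp add: y_def linear_diff[OF lin(2)] orthogonal_projector_idem[OF r])
  with op_le_inner[OF le, of y] have "(norm (p y))\<^sup>2 \<le> 0"
    using orthogonal_projector_norm_sq[OF p, of y] by simp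
  then show ?thesis by (simp add: y_def linear_diff[OF lin(1)])
qed

text \<open>The difference \<open>d\<close> is again a projection, and
  \<open>cinner (d x) x = cinner (d x) (d x)\<close> is nonnegative.\<close>

lemma op_leI_projection:
  assumes p: "projection p" and r: "projection r" and pr: "\<And>x. p (r x) = p x"
  shows "op_le p r"
proof -
  note po = projection_orthogonal_projector[OF p] and ro = projection_orthogonal_projector[OF r]
  define d where "d = (\<lambda>x. r x - p x)"
  have lin: "linear p" "linear r" using po ro by (auto simp: orthogonal_projector_def)
  have rp: "r (p x) = p x" for x by (rule orthogonal_projector_comp_commute[OF po ro pr])
  have "linear d" unfolding d_def by (intro linear_compose_sub lin)
  then have "orthogonal_projector d"
    using po ro pr rp
    by (simp add: orthogonal_projector_def d_def linear_diff[OF lin(1)] linear_diff[OF lin(2)]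
        inner_diff_left inner_diff_right)
  moreover have d: "bounded_clinear d"
    using p r unfolding d_def projection_def by (intro bounded_clinear_diff) auto
  ultimately have "projection d" by (intro projectionI) (auto simp: bounded_clinear_scaleC)
  then have "cinner (d x) x = cinner (d x) (d x)" for x
    unfolding projection_def by (metis comp_apply)
  then have "positive_op d"
    using d by (simp add: positive_op_def cinner_self_real Re_cinner)
  then show ?thesis by (simp add: op_le_def d_def)
qed

lemma projector_increment_norm:
  assumes p: "orthogonal_projector p" and r: "orthogonal_projector r" and pr: "\<And>x. p (r x) = p x"
  shows "(norm (r x - p x))\<^sup>2 = (norm (r x))\<^sup>2 - (norm (p x))\<^sup>2"
  using orthogonal_projector_norm_diff_sq[OF p, of "r x"] pr by simp

text \<open>Turns the least upper bound in the lattice of projections into a strong limit.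
  Orthogonal increments give a pointwise limit \<open>L\<close>, which is a projection above every
  \<open>q s\<close>; minimality of \<open>id\<close> then forces \<open>L\<close> to be the
  identity.\<close>

lemma increasing_projections_strong_limit:
  fixes q :: "real \<Rightarrow> 'h::complex_hilbert_space \<Rightarrow> 'h"
  assumes q: "\<And>t. 0 \<le> t \<Longrightarrow> projection (q t)"
    and mono: "\<And>s t. 0 \<le> s \<Longrightarrow> s \<le> t \<Longrightarrow> op_le (q s) (q t)"
    and lub: "op_lub (Collect projection) (q ` {0..}) id"
  shows "((\<lambda>t. q t x) \<longlongrightarrow> x) at_top"
proof -
  note qo = projection_orthogonal_projector[OF q]
  have qq: "q s (q t x) = q s x" if "0 \<le> s" "s \<le> t" for s t x
    using that by (intro op_le_projection_comp qo mono) auto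
  have nonneg: "\<forall>\<^sub>F t::real in at_top. 0 \<le> t" by (rule eventually_ge_at_top)
  have "\<exists>l. ((\<lambda>t. q t x) \<longlongrightarrow> l) at_top" for x
  proof (rule orthogonal_increments_convergent[where D="{0..}" and B="(norm x)\<^sup>2"])
    fix s :: real assume s: "s \<in> {0..}"
    show "\<forall>\<^sub>F t in at_top. t \<in> {0..} \<and>
        (norm (q t x - q s x))\<^sup>2 \<le> (norm (q t x))\<^sup>2 - (norm (q s x))\<^sup>2"
      using eventually_ge_at_top[of s]
    proof eventually_elim
      case (elim t)
      have "(norm (q t x - q s x))\<^sup>2 = (norm (q t x))\<^sup>2 - (norm (q s x))\<^sup>2"
        using s elim by (intro projector_increment_norm qo qq) auto
      then show ?case using s elim by simp
    qed
    show "(norm (q s x))\<^sup>2 \<le> (norm x)\<^sup>2"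
      using s by (intro power_mono orthogonal_projector_norm_le qo) auto
  qed auto
  then obtain L where L: "\<And>x. ((\<lambda>t. q t x) \<longlongrightarrow> L x) at_top" by metis
  have eqI: "L x = y" if "((\<lambda>t. q t x) \<longlongrightarrow> y) at_top" for x y
    using tendsto_unique[OF _ L that] by simp
  \<comment> \<open>The \<open>q t\<close> are constrained only for \<open>t \<ge> 0\<close>;
    identities valid at those times pass to \<open>L\<close>.\<close>
  have evI: "L x = y" if "\<And>t. 0 \<le> t \<Longrightarrow> q t x = f t" "(f \<longlongrightarrow> y) at_top" for x y f
  proof (rule eqI, rule Lim_transform_eventually[OF that(2)])
    show "\<forall>\<^sub>F t in at_top. f t = q t x" using nonneg by eventually_elim (simp add: that(1))
  qed
  have qlin: "linear (q t)" if "0 \<le> t" for t using qo[OF that] by (simp add: orthogonal_projector_def)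
  have "L (x + y) = L x + L y" for x y
    by (rule evI[where f="\<lambda>t. q t x + q t y"]) (auto intro: tendsto_intros L simp: linear_add[OF qlin])
  moreover have "L (c *\<^sub>R x) = c *\<^sub>R L x" for c x
    by (rule evI[where f="\<lambda>t. c *\<^sub>R q t x"]) (auto intro: tendsto_intros L simp: linear_scale[OF qlin])
  ultimately have lin: "linear L" by (rule linearI)
  have qL: "q s (L x) = q s x" if s: "0 \<le> s" for s x
  proof (rule tendsto_unique)
    show "((\<lambda>t. q s (q t x)) \<longlongrightarrow> q s (L x)) at_top"
      by (rule bounded_linear.tendsto[OF orthogonal_projector_bounded_linear[OF qo[OF s]] L])
    have "\<forall>\<^sub>F t in at_top. q s x = q s (q t x)"
      using eventually_ge_at_top[of s] by eventually_elim (simp add: qq s)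
    then show "((\<lambda>t. q s (q t x)) \<longlongrightarrow> q s x) at_top"
      by (rule Lim_transform_eventually[OF tendsto_const])
  qed simp
  \<comment> \<open>By \<open>qL\<close>, the families converging to \<open>L (L x)\<close> and to
    \<open>L x\<close> agree at nonnegative times.\<close>
  have "L (L x) = L x" for x by (rule evI[OF qL L])
  moreover have "inner (L x) y = inner x (L y)" for x y
  proof (rule tendsto_unique)
    show "((\<lambda>t. inner (q t x) y) \<longlongrightarrow> inner (L x) y) at_top" by (intro tendsto_intros L)
    have "((\<lambda>t. inner x (q t y)) \<longlongrightarrow> inner x (L y)) at_top" by (intro tendsto_intros L)
    moreover have "\<forall>\<^sub>F t in at_top. inner x (q t y) = inner (q t x) y"
      using nonneg by eventually_elim (simp add: orthogonal_projector_self_adjoint[OF qo])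
    ultimately show "((\<lambda>t. inner (q t x) y) \<longlongrightarrow> inner x (L y)) at_top"
      by (rule Lim_transform_eventually)
  qed simp
  ultimately have Lo: "orthogonal_projector L" using lin by (simp add: orthogonal_projector_def)
  have "L (c *\<^sub>C x) = c *\<^sub>C L x" for c x
    by (rule evI[where f="\<lambda>t. c *\<^sub>C q t x"])
      (use q in \<open>auto intro: bounded_linear.tendsto[OF bounded_linear_scaleC] L
         simp: projection_def bounded_clinear_scaleC\<close>)
  with Lo have Lp: "projection L" by (rule projectionI)
  have "op_le (q s) L" if "0 \<le> s" for s using that by (intro op_leI_projection q Lp qL)
  \<comment> \<open>\<open>L\<close> is one of the upper bounds among projections, so it lies above
    the least one.\<close>
  then have "op_le id L" using lub Lp by (auto simp: op_lub_def)
  from op_le_inner[OF this, of x] have "(norm x)\<^sup>2 \<le> (norm (L x))\<^sup>2"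
    by (simp add: orthogonal_projector_norm_sq[OF Lo] power2_norm_eq_inner[of x])
  then have "(norm (x - L x))\<^sup>2 \<le> 0" by (simp add: orthogonal_projector_norm_diff_sq[OF Lo])
  then have "L x = x" by simp
  then show ?thesis using L[of x] by simp
qed

section \<open>Stopped martingales\<close>

lemma orthogonal_projector_id: "orthogonal_projector id"
  by (simp add: orthogonal_projector_def module_hom_id linear_id)

section \<open>The projections attached to a filtration and a stopping time\<close>

lemma Ht_properties:
  assumes "filtration A F" "0 \<le> t"
  shows "closed (Ht F \<Omega> t)" "csubspace (Ht F \<Omega> t)"
    and "a \<in> F t \<Longrightarrow> x \<in> Ht F \<Omega> t \<Longrightarrow> a x \<in> Ht F \<Omega> t"
proof -
  have "von_neumann_algebra (F t)" using assms by (simp add: filtration_def)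
  then show "closed (Ht F \<Omega> t)" "csubspace (Ht F \<Omega> t)"
    "a \<in> F t \<Longrightarrow> x \<in> Ht F \<Omega> t \<Longrightarrow> a x \<in> Ht F \<Omega> t"
    unfolding Ht_def by (auto intro: csubspace_orbit_closure orbit_closure_invariant)
qed

lemma Ht_mono:
  assumes "filtration A F" "0 \<le> s" "s \<le> t"
  shows "Ht F \<Omega> s \<subseteq> Ht F \<Omega> t"
proof -
  have "F s \<subseteq> F t" using assms by (simp add: filtration_def)
  then show ?thesis unfolding Ht_def by (intro closure_mono image_mono)
qed

lemma orthogonal_projector_Pt:
  "filtration A F \<Longrightarrow> 0 \<le> t \<Longrightarrow> orthogonal_projector (Pt F \<Omega> t)"
  unfolding Pt_def by (intro orthogonal_projector_orth_proj Ht_properties(1,2))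

text \<open>With \<open>ereal\<close> as time type, infinity is an ordinary time at which both
  families are the identity, so the time projections at finite times and at infinity fall under the
  same lemmas. Commutation holds because \<open>q s\<close> belongs to \<open>F t\<close> for
  \<open>s \<le> t\<close> and leaves \<open>Ht F \<Omega> t\<close> invariant.\<close>

lemma adapted_projectors_ext:
  fixes F :: "real \<Rightarrow> ('h::complex_hilbert_space \<Rightarrow> 'h) set"
  assumes F: "filtration A F" and q: "stopping_time F q"
  shows "adapted_projectors (0::ereal) (ext_op q) (ext_op (Pt F \<Omega>))"
proof -
  have qo: "orthogonal_projector (q t)" if "0 \<le> t" for t
    using q that by (simp add: stopping_time_def projection_orthogonal_projector)
  have qF: "q t \<in> F t" if "0 \<le> t" for t
    using q that by (simp add: stopping_time_def)
  note Po = orthogonal_projector_Pt[OF F] and H = Ht_properties[OF F]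
  have qq: "q s (q t x) = q s x" if "0 \<le> s" "s \<le> t" for s t x
    using q that by (intro op_le_projection_comp qo) (auto simp: stopping_time_def)
  have PP: "Pt F \<Omega> s (Pt F \<Omega> t x) = Pt F \<Omega> s x" if "0 \<le> s" "s \<le> t" for s t x
    using that unfolding Pt_def by (intro orth_proj_tower H(1,2) Ht_mono[OF F]) auto
  have Pq: "Pt F \<Omega> t (q s x) = q s (Pt F \<Omega> t x)" if st: "0 \<le> s" "s \<le> t" for s t x
  proof (rule orthogonal_projector_swap)
    have t: "0 \<le> t" using st by simp
    show "orthogonal_projector (Pt F \<Omega> t)" "orthogonal_projector (q s)" by (intro Po qo st t)+
    fix y
    have "F s \<subseteq> F t" using F st by (simp add: filtration_def)
    then have "q s \<in> F t" using qF[OF st(1)] by blast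
    then have "q s (Pt F \<Omega> t y) \<in> Ht F \<Omega> t"
      unfolding Pt_def by (rule H(3)[OF t _ orth_proj_in[OF H(1)[OF t] H(2)[OF t]]])
    then show "Pt F \<Omega> t (q s (Pt F \<Omega> t y)) = q s (Pt F \<Omega> t y)"
      unfolding Pt_def by (intro orth_proj_fixes H(1,2) t)
  qed
  have fin: "ext_op a t = a (real_of_ereal t) \<and> 0 \<le> real_of_ereal t" if "0 \<le> t" "t \<noteq> \<infinity>"
    for a :: "real \<Rightarrow> 'h \<Rightarrow> 'h" and t
    using that by (simp add: ext_op_def real_of_ereal_pos)
  have inf: "ext_op a \<infinity> = id" for a :: "real \<Rightarrow> 'h \<Rightarrow> 'h" by (simp add: ext_op_def)
  have le: "real_of_ereal s \<le> real_of_ereal t \<and> s \<noteq> \<infinity>" if "0 \<le> s" "s \<le> t" "t \<noteq> \<infinity>" for s t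
    using that by (cases s; cases t) auto
  show ?thesis
  proof
    fix s t :: ereal and x
    show "ext_op q 0 x = 0" using q by (simp add: ext_op_def stopping_time_def)
    assume s: "0 \<le> s"
    show "orthogonal_projector (ext_op q s)" "orthogonal_projector (ext_op (Pt F \<Omega>) s)"
      using s fin[OF s] qo Po by (cases "s = \<infinity>"; simp add: inf orthogonal_projector_id)+
    assume st: "s \<le> t"
    have t: "0 \<le> t" using s st by simp
    show "ext_op q s (ext_op q t x) = ext_op q s x"
      "ext_op (Pt F \<Omega>) s (ext_op (Pt F \<Omega>) t x) = ext_op (Pt F \<Omega>) s x"
      "ext_op (Pt F \<Omega>) t (ext_op q s x) = ext_op q s (ext_op (Pt F \<Omega>) t x)"
      using fin[OF s] fin[OF t] le[OF s st] qq PP Pq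
      by (cases "t = \<infinity>"; simp add: inf)+
  qed
qed

theorem theorem2:
  fixes A :: "('h::complex_hilbert_space \<Rightarrow> 'h) set"
    and F :: "real \<Rightarrow> ('h \<Rightarrow> 'h) set"
    and E :: "real \<Rightarrow> ('h \<Rightarrow> 'h) \<Rightarrow> ('h \<Rightarrow> 'h)"
    and \<Omega> :: 'h
    and q :: "real \<Rightarrow> 'h \<Rightarrow> 'h"
    and \<xi> :: "real \<Rightarrow> 'h"
  assumes "von_neumann_algebra A"
    and "cyclic_vector A \<Omega>"
    and "separating_vector A \<Omega>"
    and "norm \<Omega> = 1"
    and "filtration A F"
    and "\<And>t. 0 \<le> t \<Longrightarrow> conditional_expectation A (F t) (E t)"
    and "\<And>t. 0 \<le> t \<Longrightarrow> normal_map A (F t) (E t)"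
    and "\<And>t a. 0 \<le> t \<Longrightarrow> a \<in> A \<Longrightarrow>
           vector_functional \<Omega> (E t a) = vector_functional \<Omega> a"
    and "stopping_time F q"
    and "martingale F \<Omega> \<xi>"
    and "bounded ((\<lambda>t. time_proj F \<Omega> q \<infinity> (\<xi> t)) ` {0..})"
  shows "can_be_stopped q \<xi> \<and>
         ((\<lambda>u. time_proj F \<Omega> q (ereal u) (\<xi> u)) \<longlongrightarrow> stopped q \<xi>) at_top \<and>
         ((\<lambda>t. time_proj F \<Omega> q \<infinity> (\<xi> t)) \<longlongrightarrow> stopped q \<xi>) at_top"
proof -
  interpret adapted_projectors "0::ereal" "ext_op q" "ext_op (Pt F \<Omega>)"
    using assms(5,9) by (rule adapted_projectors_ext)
  have partition_time_proj: "partition_time_proj F \<Omega> q \<theta> x = partition_op \<theta> x" for \<theta> x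
    by (simp add: partition_time_proj_def partition_op_def)
  have time_proj: "time_proj F \<Omega> q u x = time_projection u x" for u x
    by (simp add: time_proj_def time_projection_def partition_time_proj)
  have martingale: "Pt F \<Omega> s (\<xi> t) = \<xi> s" if "0 \<le> s" "s \<le> t" for s t
    using assms(10) that by (simp add: martingale_def)
  have ext: "ext_op a (ereal t) = a t" for a :: "real \<Rightarrow> 'h \<Rightarrow> 'h" and t by (simp add: ext_op_def)

  \<comment> \<open>Since \<open>Pt F \<Omega> t (\<xi> u) = \<xi> t\<close> for
    \<open>0 \<le> t \<le> u\<close>, the stopped sums are partition operators applied to the single
    vector \<open>\<xi> u\<close>. The embedding \<open>ereal\<close> matches partitions in the two
    time types.\<close>
  have stopped_at: "stopped_at q \<xi> u = time_projection (ereal u) (\<xi> u)" if u: "0 \<le> u" for u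
    unfolding stopped_at_def
  proof (rule tendsto_Lim)
    have image: "ereal ` {0..u} = {0..ereal u}"
    proof (intro equalityI subsetI)
      fix t assume "t \<in> {0..ereal u}"
      then show "t \<in> ereal ` {0..u}" by (cases t) auto
    qed auto
    have "finite_subsets_at_top {0..ereal u} = filtermap ((`) ereal) (finite_subsets_at_top {0..u})"
      unfolding image[symmetric] by (rule filtermap_image_finite_subsets_at_top[symmetric]) simp
    with tendsto_time_projection[of "ereal u" "\<xi> u"] u
    have "((\<lambda>\<theta>. partition_op (ereal ` \<theta>) (\<xi> u)) \<longlongrightarrow> time_projection (ereal u) (\<xi> u))
        (finite_subsets_at_top {0..u})"
      by (simp add: filterlim_filtermap)
    moreover have "\<forall>\<^sub>F \<theta> in finite_subsets_at_top {0..u}.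
        partition_op (ereal ` \<theta>) (\<xi> u) = partition_sum (\<lambda>s t. q t (\<xi> t) - q s (\<xi> t)) \<theta>"
    proof (rule eventually_finite_subsets_at_top_weakI)
      fix \<theta> assume \<theta>: "finite \<theta>" "\<theta> \<subseteq> {0..u}"
      show "partition_op (ereal ` \<theta>) (\<xi> u) = partition_sum (\<lambda>s t. q t (\<xi> t) - q s (\<xi> t)) \<theta>"
        unfolding partition_op_def
      proof (rule partition_sum_image)
        show "strict_mono_on \<theta> ereal" by (simp add: strict_mono_on_def)
        fix s t assume "s \<in> \<theta>" "t \<in> \<theta>"
        then show "ext_op q (ereal t) (ext_op (Pt F \<Omega>) (ereal t) (\<xi> u)) -
            ext_op q (ereal s) (ext_op (Pt F \<Omega>) (ereal t) (\<xi> u)) = q t (\<xi> t) - q s (\<xi> t)"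
          using \<theta> by (auto simp: ext martingale subset_eq)
      qed (rule \<theta>)
    qed
    ultimately show "(partition_sum (\<lambda>s t. q t (\<xi> t) - q s (\<xi> t)) \<longlongrightarrow>
        time_projection (ereal u) (\<xi> u)) (finite_subsets_at_top {0..u})"
      by (rule Lim_transform_eventually)
  qed simp

  define \<eta> where "\<eta> t = time_projection \<infinity> (\<xi> t)" for t
  \<comment> \<open>\<open>P_time_projection\<close> applies at infinity because
    \<open>ext_op q \<infinity>\<close> is the identity.\<close>
  have \<eta>: "Pt F \<Omega> s (\<eta> t) = \<eta> s" if st: "0 \<le> s" "s \<le> t" for s t
    using P_time_projection[of "ereal s" \<infinity> "\<xi> t"] st
    by (simp add: \<eta>_def ext martingale ext_op_def[of _ \<infinity>])
  obtain B where B: "\<And>t. 0 \<le> t \<Longrightarrow> norm (\<eta> t) \<le> B"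
    using assms(11) by (auto simp: bounded_iff time_proj \<eta>_def)
  have "\<exists>l. (\<eta> \<longlongrightarrow> l) at_top"
  proof (rule orthogonal_increments_convergent[where D="{0..}" and B="B\<^sup>2"])
    fix s :: real assume s: "s \<in> {0..}"
    show "\<forall>\<^sub>F t in at_top. t \<in> {0..} \<and> (norm (\<eta> t - \<eta> s))\<^sup>2 \<le> (norm (\<eta> t))\<^sup>2 - (norm (\<eta> s))\<^sup>2"
      using eventually_ge_at_top[of s]
    proof eventually_elim
      case (elim t)
      \<comment> \<open>\<open>\<eta> s\<close> is the orthogonal projection of
        \<open>\<eta> t\<close>, so Pythagoras gives the estimate with equality.\<close>
      then show ?case
        using s orthogonal_projector_norm_diff_sq[OF orthogonal_projector_Pt[OF assms(5), of s \<Omega>], of "\<eta> t"]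
        by (simp add: \<eta>)
    qed
    show "(norm (\<eta> s))\<^sup>2 \<le> B\<^sup>2" using s by (intro power_mono B) auto
  qed auto
  then obtain l where l: "(\<eta> \<longlongrightarrow> l) at_top" ..

  have ql: "((\<lambda>t. q t l) \<longlongrightarrow> l) at_top"
    using assms(9) by (intro increasing_projections_strong_limit) (auto simp: stopping_time_def)
  \<comment> \<open>Operator and argument both move with \<open>t\<close>; as each
    \<open>q t\<close> is a contraction, replacing \<open>\<eta> t\<close> by \<open>l\<close> costs
    at most \<open>norm (\<eta> t - l)\<close>.\<close>
  have "((\<lambda>t. q t (\<eta> t) - q t l) \<longlongrightarrow> 0) at_top"
  proof (rule Lim_null_comparison)
    show "((\<lambda>t. norm (\<eta> t - l)) \<longlongrightarrow> 0) at_top"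
      using l by (simp add: tendsto_norm_zero LIM_zero)
    show "\<forall>\<^sub>F t in at_top. norm (q t (\<eta> t) - q t l) \<le> norm (\<eta> t - l)"
      using eventually_ge_at_top[of 0]
    proof eventually_elim
      case (elim t)
      then have qt: "orthogonal_projector (q t)" using Q_projector[of "ereal t"] by (simp add: ext)
      then have "linear (q t)" by (simp add: orthogonal_projector_def)
      then show ?case using orthogonal_projector_norm_le[OF qt, of "\<eta> t - l"] by (simp add: linear_diff)
    qed
  qed
  from tendsto_add[OF this ql] have q\<eta>: "((\<lambda>t. q t (\<eta> t)) \<longlongrightarrow> l) at_top" by simp
  \<comment> \<open>Cutting the time projection at infinity down by \<open>q t\<close> gives the one
    at time \<open>t\<close>.\<close>
  have "\<forall>\<^sub>F t in at_top. q t (\<eta> t) = time_projection (ereal t) (\<xi> t)"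
    using eventually_ge_at_top[of 0]
  proof eventually_elim
    case (elim t)
    then show ?case using Q_time_projection[of "ereal t" \<infinity> "\<xi> t"] by (simp add: ext \<eta>_def)
  qed
  with q\<eta> have lim: "((\<lambda>t. time_projection (ereal t) (\<xi> t)) \<longlongrightarrow> l) at_top"
    by (rule Lim_transform_eventually)
  have "\<forall>\<^sub>F t in at_top. time_projection (ereal t) (\<xi> t) = stopped_at q \<xi> t"
    using eventually_ge_at_top[of 0] by eventually_elim (simp add: stopped_at)
  with lim have st: "(stopped_at q \<xi> \<longlongrightarrow> l) at_top"
    by (rule Lim_transform_eventually)
  then have "stopped q \<xi> = l" unfolding stopped_def by (intro tendsto_Lim) simp
  then show ?thesis
    using st lim l by (auto simp: can_be_stopped_def time_proj \<eta>_def[abs_def])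
qed

end
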